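(* Let $h\in\mathbb R$ and $\gamma>0$, and let $f_x(y)$ be the density at $y$ of the Gaussian law $\mathcal N(hx,\gamma^2)$. For $m\in\mathbb R$, $\sigma^2>0$ and $y\in\mathbb R$ set $$\hat m=\frac{m\gamma^2+hy\sigma^2}{\gamma^2+h^2\sigma^2},\qquad \hat\sigma^2=\frac{\sigma^2\gamma^2}{\gamma^2+h^2\sigma^2}.$$ 1. If $\nu=\mathcal N(m,\sigma^2)$ (case $i=0$), then $\varphi_y(\nu)=\mathcal N(\hat m,\hat\sigma^2)$. 2. For every integer $i\ge 1$ and all $\mu,m\in\mathbb R$, $\sigma^2>0$, if $\nu=\nu^i_{(\mu,m,\sigma^2)}$, then $\varphi_y(\nu)=\nu^i_{(\mu,\hat m,\hat\sigma^2)}$. Consequently, for all $y\in\mathbb R$ and all $i\ge 0$, $\varphi_y(\nu^i_{(\mu,m,\sigma^2)})=\nu^{t_y(i)}_{T_y(\mu,m,\sigma^2)}$ with $t_y(i)=i$ and $T_y(\mu,m,\sigma^2)=(\mu,\hat m,\hat\sigma^2)$ (where $\mu=0$ when $i=0$).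
   Context: The setting is the one-dimensional linear model with observation $y_n=hx_n+\gamma w_n$, with $(w_n)$ i.i.d. standard Gaussian independent of the signal $(x_n)$, so that the conditional law of $y_n$ given $x_n=x$ is $f_x(y)\,dy=\mathcal N(hx,\gamma^2)$. For a probability measure $\nu$ on $\mathbb R$, the updating operator is $\varphi_y(\nu)(dx)=f_x(y)\nu(dx)/p_\nu(y)$ with $p_\nu(y)=\int_{\mathbb R}\nu(d\xi)f_\xi(y)$. For $m\in\mathbb R$, $\sigma^2>0$ put $\nu^0_{(0,m,\sigma^2)}=\mathcal N(m,\sigma^2)$. For $i\ge 1$, $\mu,m\in\mathbb R$, $\sigma^2>0$ put $$\nu^i_{(\mu,m,\sigma^2)}(dx)=\frac{(x+\mu)^{2i}}{C_{2i}(m+\mu;\sigma^2)}\,\nu^0_{(0,m,\sigma^2)}(dx),\qquad C_{2i}(m+\mu;\sigma^2)=\mathbb E\big((\sigma X+\mu+m)^{2i}\big),$$ where $X$ is a standard Gaussian random variable. *)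

theory Defs
  imports "HOL-Probability.Probability"
begin

text \<open>
  The library's \<^const>\<open>normal_density\<close> takes the standard deviation, whereas the Gaussian laws
  here are parametrized by the variance.
\<close>

definition gaussian :: "real \<Rightarrow> real \<Rightarrow> real measure" where
  "gaussian m v = density lborel (\<lambda>x. ennreal (normal_density m (sqrt v) x))"

text \<open>\<open>obs_density h \<gamma> x\<close> is the density of \<open>h * x + \<gamma> * w\<close> for a standard Gaussian \<open>w\<close>, for \<open>\<gamma> > 0\<close>.\<close>

definition obs_density :: "real \<Rightarrow> real \<Rightarrow> real \<Rightarrow> real \<Rightarrow> real" where
  "obs_density h \<gamma> x y = normal_density (h * x) \<gamma> y"

definition marginal_density :: "real \<Rightarrow> real \<Rightarrow> real measure \<Rightarrow> real \<Rightarrow> real" where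
  "marginal_density h \<gamma> \<nu> y = (\<integral>\<xi>. obs_density h \<gamma> \<xi> y \<partial>\<nu>)"

definition update :: "real \<Rightarrow> real \<Rightarrow> real \<Rightarrow> real measure \<Rightarrow> real measure" where
  "update h \<gamma> y \<nu> = density \<nu> (\<lambda>x. ennreal (obs_density h \<gamma> x y / marginal_density h \<gamma> \<nu> y))"

text \<open>\<open>gauss_moment k a v\<close> is the expectation of \<open>(\<sigma> * X + a) ^ k\<close> for \<open>X\<close> standard Gaussian, \<open>v = \<sigma>\<^sup>2\<close>.\<close>

definition gauss_moment :: "nat \<Rightarrow> real \<Rightarrow> real \<Rightarrow> real" where
  "gauss_moment k a v = (\<integral>x. (sqrt v * x + a) ^ k \<partial>gaussian 0 1)"

text \<open>
  A parameter is a triple \<open>(\<mu>, m, v)\<close> with \<open>v = \<sigma>\<^sup>2\<close>. For \<open>i = 0\<close> only the parameters with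
  \<open>\<mu> = 0\<close> are meaningful; the component \<open>\<mu>\<close> is then ignored.
\<close>

fun nu :: "nat \<Rightarrow> real \<times> real \<times> real \<Rightarrow> real measure" where
  "nu 0 (\<mu>, m, v) = gaussian m v"
| "nu (Suc i) (\<mu>, m, v) =
     density (gaussian m v)
       (\<lambda>x. ennreal ((x + \<mu>) ^ (2 * Suc i) / gauss_moment (2 * Suc i) (m + \<mu>) v))"

definition m_hat :: "real \<Rightarrow> real \<Rightarrow> real \<Rightarrow> real \<Rightarrow> real \<Rightarrow> real" where
  "m_hat h \<gamma> y m v = (m * \<gamma>\<^sup>2 + h * y * v) / (\<gamma>\<^sup>2 + h\<^sup>2 * v)"

definition v_hat :: "real \<Rightarrow> real \<Rightarrow> real \<Rightarrow> real" where
  "v_hat h \<gamma> v = v * \<gamma>\<^sup>2 / (\<gamma>\<^sup>2 + h\<^sup>2 * v)"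

definition t_map :: "real \<Rightarrow> nat \<Rightarrow> nat" where
  "t_map y i = i"

fun T_map :: "real \<Rightarrow> real \<Rightarrow> real \<Rightarrow> real \<times> real \<times> real \<Rightarrow> real \<times> real \<times> real" where
  "T_map h \<gamma> y (\<mu>, m, v) = (\<mu>, m_hat h \<gamma> y m v, v_hat h \<gamma> v)"

end

theory Submission
  imports Defs
begin

text \<open>
  As a function of \<open>x\<close>, the product of the observation density and the Gaussian prior density is a
  constant multiple of the density of \<open>\<N>(m_hat, v_hat)\<close>; the polynomial weight \<open>(x + \<mu>)\<^sup>2\<^sup>i\<close> is not
  touched by the update, so only its normalizing constant changes. The case \<open>i = 0\<close> is covered by
  the weight \<open>1\<close>, whose normalizing constant is the zeroth moment.
\<close>

text \<open>Both sides factor the joint density of signal and observation: the constant is the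
  density at \<open>y\<close> of the observation under the prior, whose law is Gaussian with mean
  \<open>h * m\<close> and variance \<open>\<gamma>\<^sup>2 + h\<^sup>2 * v\<close>. Exponents and
  prefactors are compared separately.\<close>

lemma normal_density_conjugate:
  fixes h \<gamma> m v x y :: real
  assumes "\<gamma> > 0" "v > 0"
  shows "obs_density h \<gamma> x y * normal_density m (sqrt v) x =
    normal_density (h * m) (sqrt (\<gamma>\<^sup>2 + h\<^sup>2 * v)) y *
    normal_density (m_hat h \<gamma> y m v) (sqrt (v_hat h \<gamma> v)) x"
proof -
  define D where "D = \<gamma>\<^sup>2 + h\<^sup>2 * v"
  have D: "D > 0" using assms by (auto simp: D_def intro!: add_pos_nonneg)
  have vh: "v_hat h \<gamma> v = v * \<gamma>\<^sup>2 / D" by (simp add: v_hat_def D_def)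
  have mh: "m_hat h \<gamma> y m v = (m * \<gamma>\<^sup>2 + h * y * v) / D" by (simp add: m_hat_def D_def)
  have vh_pos: "v_hat h \<gamma> v > 0" using assms D by (simp add: vh)
  have exponents: "- (y - h * x)\<^sup>2 / (2 * \<gamma>\<^sup>2) + - (x - m)\<^sup>2 / (2 * v) =
      - (y - h * m)\<^sup>2 / (2 * D) + - (x - m_hat h \<gamma> y m v)\<^sup>2 / (2 * v_hat h \<gamma> v)"
  proof -
    \<comment> \<open>Completing the square in \<open>x\<close>, written as a polynomial identity
      over the common denominator \<open>2 * v * \<gamma>\<^sup>2 * D\<close>.\<close>
    have *: "v * (y - h * x)\<^sup>2 * D + \<gamma>\<^sup>2 * (x - m)\<^sup>2 * D =
        v * \<gamma>\<^sup>2 * (y - h * m)\<^sup>2 + (x * D - (m * \<gamma>\<^sup>2 + h * y * v))\<^sup>2"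
      unfolding D_def by algebra
    have "x - m_hat h \<gamma> y m v = (x * D - (m * \<gamma>\<^sup>2 + h * y * v)) / D"
      using D by (simp add: mh field_simps)
    then have "(x - m_hat h \<gamma> y m v)\<^sup>2 / (2 * v_hat h \<gamma> v) =
        (x * D - (m * \<gamma>\<^sup>2 + h * y * v))\<^sup>2 / (2 * v * \<gamma>\<^sup>2 * D)"
      using D by (simp add: vh power_divide power2_eq_square)
    moreover have "(y - h * m)\<^sup>2 / (2 * D) = v * \<gamma>\<^sup>2 * (y - h * m)\<^sup>2 / (2 * v * \<gamma>\<^sup>2 * D)"
      using assms by simp
    moreover have "(y - h * x)\<^sup>2 / (2 * \<gamma>\<^sup>2) = v * (y - h * x)\<^sup>2 * D / (2 * v * \<gamma>\<^sup>2 * D)"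
      using assms D by simp
    moreover have "(x - m)\<^sup>2 / (2 * v) = \<gamma>\<^sup>2 * (x - m)\<^sup>2 * D / (2 * v * \<gamma>\<^sup>2 * D)"
      using assms D by simp
    ultimately have "(y - h * x)\<^sup>2 / (2 * \<gamma>\<^sup>2) + (x - m)\<^sup>2 / (2 * v) =
        (y - h * m)\<^sup>2 / (2 * D) + (x - m_hat h \<gamma> y m v)\<^sup>2 / (2 * v_hat h \<gamma> v)"
      using * by (metis add_divide_distrib)
    then show ?thesis by (simp only: minus_divide_left [symmetric] minus_add_distrib [symmetric])
  qed
  \<comment> \<open>The product of the two variances is the same on both sides, hence so are the
    prefactors.\<close>
  have "D * v_hat h \<gamma> v = \<gamma>\<^sup>2 * v" using D by (simp add: vh)
  then have "sqrt (2 * pi * \<gamma>\<^sup>2) * sqrt (2 * pi * v) = sqrt (2 * pi * D) * sqrt (2 * pi * v_hat h \<gamma> v)"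
    by (simp add: real_sqrt_mult [symmetric] mult_ac)
  then show ?thesis
    using exponents assms D vh_pos
    by (simp add: obs_density_def normal_density_def D_def [symmetric] mult_exp_exp)
qed

text \<open>The binomial theorem reduces this to the standard moments. Integrability is what lets a
  vanishing integral force the integrand to vanish almost everywhere.\<close>

lemma integrable_gauss_moment:
  "integrable lborel (\<lambda>x. std_normal_density x * (s * x + a) ^ k)"
proof -
  have "integrable lborel
      (\<lambda>x. \<Sum>j\<le>k. (of_nat (k choose j) * s ^ j * a ^ (k - j)) * (std_normal_density x * x ^ j))"
    by (intro Bochner_Integration.integrable_sum integrable_mult_right integrable_std_normal_moment)
  then show ?thesis
    by (simp add: binomial_ring sum_distrib_left power_mult_distrib mult_ac)
qed

lemma gauss_moment_std_lborel:
  "gauss_moment k a v = (\<integral>x. std_normal_density x * (sqrt v * x + a) ^ k \<partial>lborel)"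
  by (simp add: gauss_moment_def gaussian_def integral_real_density)

text \<open>Substituting \<open>m + sqrt v * x\<close> for \<open>x\<close>, with the Jacobian
  \<open>sqrt v\<close> absorbed by the density, identifies the moment with the integral that
  normalizes \<open>nu\<close>.\<close>

lemma gauss_moment_lborel:
  assumes "v > 0"
  shows "gauss_moment k (m + \<mu>) v = (\<integral>x. normal_density m (sqrt v) x * (x + \<mu>) ^ k \<partial>lborel)"
proof -
  have scale: "sqrt v * normal_density m (sqrt v) (m + sqrt v * x) = std_normal_density x" for x
    using assms by (simp add: normal_density_def real_sqrt_mult power_mult_distrib)
  have "(\<integral>x. normal_density m (sqrt v) x * (x + \<mu>) ^ k \<partial>lborel) =
      sqrt v * (\<integral>x. normal_density m (sqrt v) (m + sqrt v * x) * (m + sqrt v * x + \<mu>) ^ k \<partial>lborel)"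
    using assms lborel_integral_real_affine
      [of "sqrt v" "\<lambda>x. normal_density m (sqrt v) x * (x + \<mu>) ^ k" m] by simp
  also have "\<dots> = (\<integral>x. std_normal_density x * (sqrt v * x + (m + \<mu>)) ^ k \<partial>lborel)"
    unfolding integral_mult_right_zero [symmetric] scale [symmetric] by (simp add: ac_simps)
  finally show ?thesis by (simp add: gauss_moment_std_lborel)
qed

lemma gauss_moment_nonneg:
  assumes "even k"
  shows "gauss_moment k a v \<ge> 0"
  using assms by (simp add: gauss_moment_def zero_le_even_power)

text \<open>An even power of a nonconstant affine function is nonnegative and vanishes at one point
  at most, a Lebesgue null set, so its Gaussian integral cannot be zero.\<close>

lemma gauss_moment_pos:
  assumes "even k" "v > 0"
  shows "gauss_moment k a v > 0"
proof (rule ccontr)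
  assume "\<not> gauss_moment k a v > 0"
  with gauss_moment_nonneg [OF assms(1)]
  have "gauss_moment k a v = 0" by (simp add: order.antisym not_less)
  then have "AE x in lborel. std_normal_density x * (sqrt v * x + a) ^ k = 0"
    using assms integrable_gauss_moment
    by (subst (asm) gauss_moment_std_lborel, subst (asm) integral_nonneg_eq_0_iff_AE)
       (auto simp: zero_le_even_power)
  then have "AE x in lborel. x = - a / sqrt v"
  proof (rule eventually_mono)
    fix x :: real
    assume "std_normal_density x * (sqrt v * x + a) ^ k = 0"
    then have "sqrt v * x + a = 0" by (simp add: normal_density_def)
    then show "x = - a / sqrt v" using assms by (simp add: field_simps)
  qed
  with AE_lborel_singleton [of "- a / sqrt v"] have "AE x in (lborel :: real measure). False"
    by eventually_elim simp
  then show False by (simp add: eventually_False ae_filter_eq_bot_iff)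
qed

text \<open>Brings both defining equations of \<open>nu\<close> to one form relative to Lebesgue
  measure, so that a single computation serves every \<open>i\<close>.\<close>

lemma nu_eq_density_lborel:
  assumes "v > 0"
  shows "nu i (\<mu>, m, v) = density lborel (\<lambda>x. ennreal
    (normal_density m (sqrt v) x * (x + \<mu>) ^ (2 * i) / gauss_moment (2 * i) (m + \<mu>) v))"
proof (cases i)
  case 0
  have "gauss_moment 0 (m + \<mu>) v = 1"
    using assms by (simp add: gauss_moment_lborel)
  then show ?thesis by (simp add: 0 gaussian_def)
next
  case (Suc j)
  then show ?thesis
    by (simp only: nu.simps gaussian_def)
       (subst density_density_eq, auto simp: ennreal_mult' [symmetric] simp del: power_Suc)
qed

lemma update_nu:
  assumes "\<gamma> > 0" "v > 0"
  shows "update h \<gamma> y (nu i (\<mu>, m, v)) = nu i (\<mu>, m_hat h \<gamma> y m v, v_hat h \<gamma> v)"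
proof -
  let ?mh = "m_hat h \<gamma> y m v" and ?vh = "v_hat h \<gamma> v"
  define K where "K = normal_density (h * m) (sqrt (\<gamma>\<^sup>2 + h\<^sup>2 * v)) y"
  define C where "C = gauss_moment (2 * i) (m + \<mu>) v"
  define C' where "C' = gauss_moment (2 * i) (?mh + \<mu>) ?vh"
  define w where "w x = normal_density m (sqrt v) x * (x + \<mu>) ^ (2 * i) / C" for x
  have D: "\<gamma>\<^sup>2 + h\<^sup>2 * v > 0" using assms by (auto intro!: add_pos_nonneg)
  have vh: "?vh > 0" using assms D by (simp add: v_hat_def)
  have K: "K > 0" using D by (simp add: K_def normal_density_pos)
  have C: "C > 0" and C': "C' > 0"
    using assms vh by (simp_all add: C_def C'_def gauss_moment_pos)
  have w_meas [measurable]: "w \<in> borel_measurable borel" unfolding w_def by measurable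
  have obs_meas [measurable]: "(\<lambda>x. obs_density h \<gamma> x y) \<in> borel_measurable borel"
    unfolding obs_density_def normal_density_def by measurable
  have w_nonneg: "w x \<ge> 0" for x
    using C by (simp add: w_def)
  have w_obs: "w x * obs_density h \<gamma> x y =
      K / C * (normal_density ?mh (sqrt ?vh) x * (x + \<mu>) ^ (2 * i))" for x
  proof -
    have "w x * obs_density h \<gamma> x y =
        (obs_density h \<gamma> x y * normal_density m (sqrt v) x) * ((x + \<mu>) ^ (2 * i) / C)"
      by (simp add: w_def)
    then show ?thesis
      by (simp add: normal_density_conjugate [OF assms] K_def)
  qed
  have nu: "nu i (\<mu>, m, v) = density lborel (\<lambda>x. ennreal (w x))"
    using assms by (simp add: nu_eq_density_lborel w_def C_def)
  have marginal: "marginal_density h \<gamma> (nu i (\<mu>, m, v)) y = K * C' / C"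
    \<comment> \<open>Integrating \<open>w_obs\<close> over \<open>x\<close> leaves the posterior
      moment \<open>C'\<close> times the factor \<open>K / C\<close>.\<close>
    using w_nonneg vh
    by (simp add: marginal_density_def nu integral_real_density w_obs C'_def gauss_moment_lborel)
  have "update h \<gamma> y (nu i (\<mu>, m, v)) =
      density lborel (\<lambda>x. ennreal (w x * (obs_density h \<gamma> x y / (K * C' / C))))"
    unfolding update_def marginal unfolding nu
    by (subst density_density_eq) (auto simp: ennreal_mult' [symmetric] w_nonneg)
  \<comment> \<open>By \<open>w_obs\<close>, the factor \<open>K / C\<close> cancels against the
    marginal \<open>K * C' / C\<close>, leaving the new normalization \<open>1 / C'\<close>.\<close>
  also have "\<dots> = nu i (\<mu>, ?mh, ?vh)"
    unfolding nu_eq_density_lborel [OF vh] C'_def [symmetric] times_divide_eq_right w_obs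
    using K C C' by simp
  finally show ?thesis .
qed

theorem proposition3p1:
  fixes h \<gamma> :: real
  assumes "\<gamma> > 0"
  shows
    "(\<forall>m v y. v > 0 \<longrightarrow>
        update h \<gamma> y (gaussian m v) = gaussian (m_hat h \<gamma> y m v) (v_hat h \<gamma> v)) \<and>
     (\<forall>i \<mu> m v y. i \<ge> 1 \<longrightarrow> v > 0 \<longrightarrow>
        update h \<gamma> y (nu i (\<mu>, m, v)) = nu i (\<mu>, m_hat h \<gamma> y m v, v_hat h \<gamma> v)) \<and>
     (\<forall>y i \<mu> m v. v > 0 \<longrightarrow> (i = 0 \<longrightarrow> \<mu> = 0) \<longrightarrow>
        update h \<gamma> y (nu i (\<mu>, m, v)) = nu (t_map y i) (T_map h \<gamma> y (\<mu>, m, v)))"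
  \<comment> \<open>The first claim is the instance \<open>i = 0\<close>, where \<open>nu\<close>
    unfolds to \<open>gaussian\<close>.\<close>
  using update_nu [OF assms] update_nu [OF assms, where i = 0]
  by (simp add: t_map_def)

end
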